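(* Let $X$ be a compact metric space and let $T$ be a topological semigroup acting on $X$ by continuous selfmaps. Then the following are equivalent: (1) the action of $T$ on $X$ is strongly proximal; (2) the induced action of $T$ on ${\cal P}(X)$ is strongly proximal.
   Context: For a complete separable metric space $Y$, ${\cal P}(Y)$ denotes the space of all regular Borel probability measures on $Y$, equipped with the weak* topology with respect to all bounded continuous functions on $Y$; with this topology ${\cal P}(Y)$ is itself a (completely metrizable, separable) metric space. $\delta_y$ denotes the point mass at $y\in Y$. If a semigroup $T$ acts on $Y$ by continuous selfmaps, then $T$ acts on ${\cal P}(Y)$ by $(t\lambda)(E)=\lambda(t^{-1}E)$ for $t\in T$, $\lambda\in{\cal P}(Y)$ and Borel $E\subset Y$, where $t^{-1}E=\{y\in Y: ty\in E\}$; this is again an action by continuous selfmaps (so the construction can be iterated, giving an action on ${\cal P}({\cal P}(Y))$). The action of $T$ on $Y$ is called strongly proximal if for every $\lambda\in{\cal P}(Y)$ there exist a sequence $(t_n)$ in $T$ and a point $y\in Y$ such that $t_n\lambda\to\delta_y$ in ${\cal P}(Y)$. *)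

theory Defs
  imports "HOL-Probability.Probability"
begin

(* Spaces are values of type 'a topology rather than type-class instances, so that the
   construction of the space of probability measures can be iterated. *)

definition borel_of :: "'a topology \<Rightarrow> 'a measure" where
  "borel_of Y = sigma (topspace Y) {U. openin Y U}"

definition regular_measure :: "'a topology \<Rightarrow> 'a measure \<Rightarrow> bool" where
  "regular_measure Y M \<longleftrightarrow>
     (\<forall>E \<in> sets (borel_of Y).
        emeasure M E = (SUP K \<in> {K. K \<subseteq> E \<and> compactin Y K}. emeasure M K) \<and>
        emeasure M E = (INF U \<in> {U. E \<subseteq> U \<and> openin Y U}. emeasure M U))"

definition prob_measures :: "'a topology \<Rightarrow> 'a measure set" where
  "prob_measures Y = {M. sets M = sets (borel_of Y) \<and> prob_space M \<and> regular_measure Y M}"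

(* The weak* topology: the coarsest topology on the regular Borel probability measures for
   which integration of each bounded continuous real function is continuous. *)
definition prob_topology :: "'a topology \<Rightarrow> 'a measure topology" where
  "prob_topology Y = topology_generated_by
     {{M \<in> prob_measures Y. (\<integral>y. f y \<partial>M) \<in> V} | f V.
        continuous_map Y euclideanreal f \<and> bounded (f ` topspace Y) \<and> open V}"

lemma topspace_prob_topology: "topspace (prob_topology Y) = prob_measures Y"
proof -
  have "prob_measures Y \<in> {{M \<in> prob_measures Y. (\<integral>y. f y \<partial>M) \<in> V} | f V.
      continuous_map Y euclideanreal f \<and> bounded (f ` topspace Y) \<and> open V}"
    by (rule CollectI, rule exI[of _ "\<lambda>_. 0"], rule exI[of _ UNIV])
       (auto intro: finite_imp_bounded finite_subset[of _ "{0}"])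
  then show ?thesis
    unfolding prob_topology_def topology_generated_by_topspace by blast
qed

definition semigroup_action ::
    "'a topology \<Rightarrow> ('t::semigroup_mult \<Rightarrow> 'a \<Rightarrow> 'a) \<Rightarrow> bool" where
  "semigroup_action Y act \<longleftrightarrow>
     (\<forall>t. continuous_map Y Y (act t)) \<and>
     (\<forall>s t. \<forall>y \<in> topspace Y. act (s * t) y = act s (act t y))"

definition induced_action ::
    "'a topology \<Rightarrow> ('t \<Rightarrow> 'a \<Rightarrow> 'a) \<Rightarrow> 't \<Rightarrow> 'a measure \<Rightarrow> 'a measure" where
  "induced_action Y act t M = distr M (borel_of Y) (act t)"

definition point_mass :: "'a topology \<Rightarrow> 'a \<Rightarrow> 'a measure" where
  "point_mass Y y = return (borel_of Y) y"

definition strongly_proximal :: "'a topology \<Rightarrow> ('t \<Rightarrow> 'a \<Rightarrow> 'a) \<Rightarrow> bool" where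
  "strongly_proximal Y act \<longleftrightarrow>
     (\<forall>M \<in> prob_measures Y. \<exists>t :: nat \<Rightarrow> 't. \<exists>y \<in> topspace Y.
        limitin (prob_topology Y) (\<lambda>n. induced_action Y act (t n) M) (point_mass Y y)
          sequentially)"

end

theory Submission
  imports Defs
begin

text \<open>
  Write \<open>P X\<close> for the space of probability measures. Both directions transport a measure between
  two levels of the construction, one by averaging and one by embedding.

  Upwards: a measure \<open>L\<close> on \<open>P X\<close> has a barycenter in \<open>P X\<close>, the average of the measures \<open>M\<close> with
  respect to \<open>L\<close>. Some sequence \<open>t n\<close> pushes the barycenter to a point mass at a point \<open>y\<close>. Testing this
  against the distance to \<open>y\<close> says that the mean distance to \<open>y\<close> under \<open>t n M\<close>, averaged once more over
  \<open>M\<close>, tends to zero. This is convergence in \<open>L\<^sup>1\<close> of nonnegative functions of \<open>M\<close>, so along a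
  subsequence the mean distance to \<open>y\<close> under \<open>t n M\<close> tends to zero for almost every \<open>M\<close>; that forces
  \<open>t n M\<close> to converge to the point mass at \<open>y\<close> (\<open>limitin_point_massI\<close>). Dominated convergence
  then carries \<open>L\<close> to the point mass at that point mass. Compactness of \<open>X\<close> makes the distance
  bounded and the barycenter regular.

  Downwards: embed \<open>X\<close> into \<open>P X\<close> by point masses and push \<open>M\<close> forward to a measure \<open>L\<close> on \<open>P X\<close>. Some
  sequence \<open>t n\<close> drives \<open>L\<close> to the point mass at some \<open>m\<close>. Evaluating integrals of functions on \<open>X\<close> shows
  that \<open>t n M\<close> converges to \<open>m\<close>. It remains to see that \<open>m\<close> is itself a point mass. The variance of a
  continuous function \<open>f\<close> on \<open>X\<close> under a measure depends continuously on the measure and vanishes at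
  every point mass, in particular throughout the orbit of the image of \<open>X\<close>, so it vanishes at \<open>m\<close>; and a
  measure under which no continuous function varies is a point mass
  (\<open>zero_variance_imp_point_mass\<close>).

  The remaining work is topological measure theory over an arbitrary topology, so that it applies both
  to \<open>X\<close> and to \<open>P X\<close>: push-forwards preserve regularity, integration and push-forward are weak*
  continuous, \<open>P X\<close> is Hausdorff, and the measure of an open set is a Borel function of the measure.
\<close>

section \<open>Borel sets and integrals of bounded continuous functions\<close>

lemma space_borel_of [simp]: "space (borel_of Y) = topspace Y"
  unfolding borel_of_def by (intro space_measure_of) (auto dest: openin_subset)

lemma sets_borel_of: "sets (borel_of Y) = sigma_sets (topspace Y) {U. openin Y U}"
  unfolding borel_of_def by (intro sets_measure_of) (auto dest: openin_subset)

lemma openin_imp_borel_of: "openin Y U \<Longrightarrow> U \<in> sets (borel_of Y)"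
  unfolding sets_borel_of by (rule sigma_sets.Basic) simp

lemma closedin_imp_borel_of: "closedin Y C \<Longrightarrow> C \<in> sets (borel_of Y)"
  by (metis closedin_def double_diff openin_imp_borel_of sets.compl_sets space_borel_of subset_refl)

lemma compactin_imp_borel_of: "Hausdorff_space Y \<Longrightarrow> compactin Y K \<Longrightarrow> K \<in> sets (borel_of Y)"
  by (simp add: closedin_imp_borel_of compactin_imp_closedin)

lemma continuous_map_borel_measurable:
  assumes "continuous_map Y Z f"
  shows "f \<in> borel_of Y \<rightarrow>\<^sub>M borel_of Z"
proof (rule measurable_sigma_sets[OF sets_borel_of])
  show "{U. openin Z U} \<subseteq> Pow (topspace Z)"
    by (auto dest: openin_subset)
  show "f \<in> space (borel_of Y) \<rightarrow> topspace Z"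
    using assms by (simp add: continuous_map_def)
  fix U assume "U \<in> {U. openin Z U}"
  then have "openin Y {x \<in> topspace Y. f x \<in> U}"
    using assms by (simp add: continuous_map_def)
  moreover have "f -` U \<inter> space (borel_of Y) = {x \<in> topspace Y. f x \<in> U}"
    by auto
  ultimately show "f -` U \<inter> space (borel_of Y) \<in> sets (borel_of Y)"
    by (simp add: openin_imp_borel_of)
qed

lemma continuous_map_real_borel_measurable:
  fixes f :: "'a \<Rightarrow> real"
  assumes "continuous_map Y euclideanreal f"
  shows "f \<in> borel_measurable (borel_of Y)"
proof (rule borel_measurableI)
  fix U :: "real set" assume "open U"
  then have "openin Y {x \<in> topspace Y. f x \<in> U}"
    using assms by (simp add: continuous_map_def)
  moreover have "f -` U \<inter> space (borel_of Y) = {x \<in> topspace Y. f x \<in> U}"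
    by auto
  ultimately show "f -` U \<inter> space (borel_of Y) \<in> sets (borel_of Y)"
    by (simp add: openin_imp_borel_of)
qed

lemma prob_measuresD:
  assumes "M \<in> prob_measures Y"
  shows "sets M = sets (borel_of Y)" "space M = topspace Y" "prob_space M" "regular_measure Y M"
  using assms sets_eq_imp_space_eq[of M "borel_of Y"] by (auto simp: prob_measures_def)

lemma integrable_bounded_continuous:
  fixes f :: "'a \<Rightarrow> real"
  assumes M: "M \<in> prob_measures Y"
    and f: "continuous_map Y euclideanreal f" "bounded (f ` topspace Y)"
  shows "integrable M f"
proof -
  note D = prob_measuresD[OF M]
  interpret prob_space M by (rule D)
  obtain B where "\<And>x. x \<in> topspace Y \<Longrightarrow> norm (f x) \<le> B"
    using f(2) by (auto simp: bounded_iff)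
  moreover have "f \<in> borel_measurable M"
    using continuous_map_real_borel_measurable[OF f(1)] D(1) by (simp cong: measurable_cong_sets)
  ultimately show ?thesis
    by (intro integrable_const_bound[of _ B]) (auto simp: D(2) intro!: AE_I2)
qed

lemma abs_integral_le_bound:
  fixes f :: "'a \<Rightarrow> real"
  assumes M: "M \<in> prob_measures Y"
    and f: "continuous_map Y euclideanreal f" "\<And>x. x \<in> topspace Y \<Longrightarrow> \<bar>f x\<bar> \<le> B"
  shows "\<bar>\<integral>x. f x \<partial>M\<bar> \<le> B"
proof -
  note D = prob_measuresD[OF M]
  interpret prob_space M by (rule D)
  have int: "integrable M f"
    by (rule integrable_bounded_continuous[OF M f(1)]) (auto simp: bounded_iff intro!: exI[of _ B] f(2))
  have "\<bar>\<integral>x. f x \<partial>M\<bar> \<le> (\<integral>x. \<bar>f x\<bar> \<partial>M)"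
    by (rule integral_abs_bound)
  also have "\<dots> \<le> (\<integral>x. B \<partial>M)"
    using int f(2) by (intro integral_mono) (auto simp: D(2))
  finally show ?thesis by (simp add: prob_space)
qed

lemma metrizable_space_mtopology_of: "metrizable_space (mtopology_of X)"
  by (simp add: mtopology_of_def Metric_space.metrizable_space_mtopology)

lemma bounded_if_compact_space:
  fixes f :: "'a \<Rightarrow> real"
  assumes "compact_space Y" "continuous_map Y euclideanreal f"
  shows "bounded (f ` topspace Y)"
  using image_compactin[OF _ assms(2), of "topspace Y"] assms(1)
  by (simp add: compact_space_def compact_imp_bounded)

section \<open>Regularity\<close>

text \<open>For a finite measure on a Hausdorff space inner regularity alone suffices: compact sets are closed,
  so outer approximation of a set is inner approximation of its complement. The real-valued
  \<open>e\<close>-form is the one in which regularity is verified and used below.\<close>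

lemma regular_measure_iff_compact_approximation:
  assumes Y: "Hausdorff_space Y" and M: "finite_measure M" "sets M = sets (borel_of Y)"
  shows "regular_measure Y M \<longleftrightarrow>
    (\<forall>E\<in>sets (borel_of Y). \<forall>e>0. \<exists>K\<subseteq>E. compactin Y K \<and> measure M E < measure M K + e)"
    (is "?L \<longleftrightarrow> ?R")
proof
  interpret finite_measure M by (rule M)
  have sp: "space M = topspace Y"
    using sets_eq_imp_space_eq[OF M(2)] by simp
  have Ks: "K \<in> sets M" if "compactin Y K" for K
    using compactin_imp_borel_of[OF Y that] M(2) by simp
  show ?R if L: ?L
  proof (intro ballI allI impI)
    fix E and e :: real
    assume E: "E \<in> sets (borel_of Y)" and e: "e > 0"
    have sup: "emeasure M E = (SUP K \<in> {K. K \<subseteq> E \<and> compactin Y K}. emeasure M K)"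
      using L E by (auto simp: regular_measure_def)
    show "\<exists>K\<subseteq>E. compactin Y K \<and> measure M E < measure M K + e"
    proof (cases "measure M E < e")
      case True
      then show ?thesis
        by (intro exI[of _ "{}"]) auto
    next
      case False
      then have "ennreal (measure M E - e) < emeasure M E"
        using e by (auto simp: emeasure_eq_measure intro: ennreal_lessI)
      then obtain K where "K \<subseteq> E" "compactin Y K" "ennreal (measure M E - e) < emeasure M K"
        unfolding sup by (auto simp: less_SUP_iff)
      moreover from this(3) have "measure M E - e < measure M K"
        using False by (simp add: emeasure_eq_measure ennreal_less_iff)
      ultimately show ?thesis
        by (intro exI[of _ K]) auto
    qed
  qed
  show ?L if R: ?R
    unfolding regular_measure_def
  proof (intro ballI conjI)
    fix E assume E: "E \<in> sets (borel_of Y)"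
    show "emeasure M E = (SUP K \<in> {K. K \<subseteq> E \<and> compactin Y K}. emeasure M K)"
    proof (rule ennreal_approx_SUP)
      show "emeasure M K \<le> emeasure M E" if "K \<in> {K. K \<subseteq> E \<and> compactin Y K}" for K
        using that E M(2) by (intro emeasure_mono) auto
      fix e :: real assume "e > 0"
      then obtain K where "K \<subseteq> E" "compactin Y K" "measure M E < measure M K + e"
        using R E by blast
      then show "\<exists>K\<in>{K. K \<subseteq> E \<and> compactin Y K}. emeasure M E \<le> emeasure M K + ennreal e"
        using \<open>e > 0\<close>
        by (intro bexI[of _ K]) (auto simp: emeasure_eq_measure simp flip: ennreal_plus)
    qed
    show "emeasure M E = (INF U \<in> {U. E \<subseteq> U \<and> openin Y U}. emeasure M U)"
    proof (rule ennreal_approx_INF)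
      show "emeasure M E \<le> emeasure M U" if "U \<in> {U. E \<subseteq> U \<and> openin Y U}" for U
        using that openin_imp_borel_of[of Y U] M(2) by (intro emeasure_mono) auto
      fix e :: real assume "e > 0"
      moreover have "topspace Y - E \<in> sets (borel_of Y)"
        using E sets.compl_sets by fastforce
      ultimately obtain K where K: "K \<subseteq> topspace Y - E" "compactin Y K"
          "measure M (topspace Y - E) < measure M K + e"
        using R by blast
      have "measure M (topspace Y - E) = measure M (space M) - measure M E"
        "measure M (topspace Y - K) = measure M (space M) - measure M K"
        using E M(2) Ks[OF K(2)] by (auto simp: sp[symmetric] finite_measure_compl)
      with K(3) have "measure M (topspace Y - K) \<le> measure M E + e"
        by simp
      moreover have "openin Y (topspace Y - K)"
        using compactin_imp_closedin[OF Y K(2)] by (simp add: openin_diff)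
      moreover have "E \<subseteq> topspace Y - K"
        using K(1) sets.sets_into_space[OF E] by auto
      ultimately show "\<exists>U\<in>{U. E \<subseteq> U \<and> openin Y U}. emeasure M U \<le> emeasure M E + ennreal e"
        using \<open>e > 0\<close>
        by (intro bexI[of _ "topspace Y - K"])
          (auto simp: emeasure_eq_measure simp flip: ennreal_plus)
    qed
  qed
qed

text \<open>Continuous images of compact sets are compact, so a compact approximation of a preimage is mapped
  to a compact approximation of the set itself.\<close>

lemma distr_prob_measures:
  assumes M: "M \<in> prob_measures Y" and h: "continuous_map Y Z h"
    and Y: "Hausdorff_space Y" and Z: "Hausdorff_space Z"
  shows "distr M (borel_of Z) h \<in> prob_measures Z"
proof -
  note D = prob_measuresD[OF M]
  interpret prob_space M by (rule D)
  have hm [measurable]: "h \<in> M \<rightarrow>\<^sub>M borel_of Z"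
    using continuous_map_borel_measurable[OF h] D(1) by (simp cong: measurable_cong_sets)
  let ?N = "distr M (borel_of Z) h"
  interpret N: prob_space ?N
    by (rule prob_space_distr) (rule hm)
  have "\<exists>K\<subseteq>E. compactin Z K \<and> measure ?N E < measure ?N K + e"
    if E: "E \<in> sets (borel_of Z)" and e: "e > 0" for E and e :: real
  proof -
    let ?E = "h -` E \<inter> space M"
    have "?E \<in> sets (borel_of Y)"
      using measurable_sets[OF hm E] D(1) by simp
    then obtain K where K: "K \<subseteq> ?E" "compactin Y K" "measure M ?E < measure M K + e"
      using D(4) e unfolding regular_measure_iff_compact_approximation[OF Y finite_measure_axioms D(1)]
      by blast
    have c: "compactin Z (h ` K)"
      using image_compactin[OF K(2) h] .
    have s: "h ` K \<in> sets (borel_of Z)"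
      by (rule compactin_imp_borel_of[OF Z c])
    have "measure M K \<le> measure M (h -` (h ` K) \<inter> space M)"
      using measurable_sets[OF hm s] K(1) by (intro finite_measure_mono) auto
    then have "measure ?N E < measure ?N (h ` K) + e"
      using K(3) by (simp add: measure_distr[OF hm] E s)
    then show ?thesis
      using c K(1) by (intro exI[of _ "h ` K"]) auto
  qed
  then have "regular_measure Z ?N"
    by (subst regular_measure_iff_compact_approximation[OF Z]) (auto intro: N.finite_measure_axioms)
  then show ?thesis
    by (auto simp: prob_measures_def intro: N.prob_space_axioms)
qed

lemma point_mass_prob_measures:
  assumes Y: "Hausdorff_space Y" and y: "y \<in> topspace Y"
  shows "point_mass Y y \<in> prob_measures Y"
proof -
  interpret prob_space "point_mass Y y"
    unfolding point_mass_def by (rule prob_space_return) (simp add: y)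
  have "\<exists>K\<subseteq>E. compactin Y K \<and> measure (point_mass Y y) E < measure (point_mass Y y) K + e"
    if E: "E \<in> sets (borel_of Y)" and e: "e > 0" for E and e :: real
  proof -
    \<comment> \<open>This intersection has full measure in \<open>E\<close>: it is \<open>{y}\<close> or empty.\<close>
    have "compactin Y (E \<inter> {y})"
      using y by (intro finite_imp_compactin) auto
    moreover from this have "E \<inter> {y} \<in> sets (borel_of Y)"
      by (rule compactin_imp_borel_of[OF Y])
    ultimately show ?thesis
      using e E
      by (intro exI[of _ "E \<inter> {y}"]) (auto simp: point_mass_def measure_return indicator_def)
  qed
  then have "regular_measure Y (point_mass Y y)"
    using regular_measure_iff_compact_approximation[OF Y finite_measure_axioms]
    by (simp add: point_mass_def)
  then show ?thesis
    by (auto simp: prob_measures_def point_mass_def intro: prob_space_axioms[unfolded point_mass_def])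
qed

text \<open>The Borel sets that can be squeezed between a closed and an open set with small difference form a
  \<open>\<sigma>\<close>-algebra, which contains the open sets because those are countable unions of closed
  sets in a metrizable space. Compactness of the space turns the closed sets into compact ones.\<close>

lemma compact_metrizable_imp_regular_measure:
  assumes X: "compact_space X" "metrizable_space X"
    and M: "finite_measure M" "sets M = sets (borel_of X)"
  shows "regular_measure X M"
proof -
  interpret finite_measure M by (rule M)
  have sp: "space M = topspace X"
    using sets_eq_imp_space_eq[OF M(2)] by simp
  have os: "openin X U \<Longrightarrow> U \<in> sets M" and cs: "closedin X U \<Longrightarrow> U \<in> sets M" for U
    using openin_imp_borel_of closedin_imp_borel_of M(2) by auto
  have "\<exists>C U. closedin X C \<and> openin X U \<and> C \<subseteq> E \<and> E \<subseteq> U \<and> measure M (U - C) < e"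
    if "E \<in> sigma_sets (topspace X) {U. openin X U}" "e > 0" for E e
    using that
  proof (induction arbitrary: e rule: sigma_sets.induct)
    case (Basic U)
    then have U: "openin X U" by simp
    then obtain C where C: "\<And>n. closedin X (C n)" "\<And>n. C n \<subseteq> C (Suc n)" "\<Union> (range C) = U"
      using X(2) open_imp_fsigma_in[of X U] unfolding fsigma_in_ascending by blast
    have "(\<lambda>n. measure M (C n)) \<longlonglongrightarrow> measure M (\<Union> (range C))"
      using C cs by (intro finite_Lim_measure_incseq) (auto intro: incseq_SucI)
    then obtain n where "dist (measure M (C n)) (measure M U) < e"
      using metric_LIMSEQ_D[OF _ \<open>e > 0\<close>] C(3) by fastforce
    moreover have "measure M (U - C n) = measure M U - measure M (C n)"
      using C U os cs by (intro finite_measure_Diff) auto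
    ultimately have "measure M (U - C n) < e"
      by (auto simp: dist_real_def)
    then show ?case
      using C U by blast
  next
    case Empty
    then show ?case
      by (intro exI[of _ "{}"]) auto
  next
    case (Compl E)
    then obtain C U where CU: "closedin X C" "openin X U" "C \<subseteq> E" "E \<subseteq> U" "measure M (U - C) < e"
      using Compl.IH[OF Compl.prems] by blast
    have "(topspace X - C) - (topspace X - U) = U - C"
      using openin_subset[OF CU(2)] by auto
    then show ?case
      using CU by (intro exI[of _ "topspace X - U"] exI[of _ "topspace X - C"]) auto
  next
    case (Union E)
    \<comment> \<open>Half of \<open>e\<close> is spent on the countably many gaps; the other half pays for replacing the
      union of all \<open>C i\<close>, which need not be closed, by a finite union.\<close>
    have "\<exists>C U. closedin X C \<and> openin X U \<and> C \<subseteq> E i \<and> E i \<subseteq> U \<and>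
        measure M (U - C) < (e / 2) * (1 / 2) ^ Suc i" for i
      using \<open>e > 0\<close> by (intro Union.IH) simp
    then obtain C U where C: "\<And>i. closedin X (C i)" and U: "\<And>i. openin X (U i)"
      and CE: "\<And>i. C i \<subseteq> E i" and EU: "\<And>i. E i \<subseteq> U i"
      and m: "\<And>i. measure M (U i - C i) < (e / 2) * (1 / 2) ^ Suc i"
      by metis
    have Cs [measurable]: "C i \<in> sets M" and Us [measurable]: "U i \<in> sets M" for i
      using C U os cs by auto
    have sums: "(\<lambda>i. (e / 2) * (1 / 2) ^ Suc i) sums ((e / 2) * 1)"
      by (intro sums_mult power_half_series)
    have summ: "summable (\<lambda>i. measure M (U i - C i))"
      by (rule summable_comparison_test'[OF sums_summable[OF sums], of 0])
        (use less_imp_le[OF m] in simp)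
    have "measure M (\<Union>i. U i - C i) \<le> (\<Sum>i. measure M (U i - C i))"
      by (intro finite_measure_subadditive_countably summ) auto
    also have "\<dots> \<le> (\<Sum>i. (e / 2) * (1 / 2) ^ Suc i)"
      by (intro suminf_le summ sums_summable[OF sums] less_imp_le[OF m])
    also have "\<dots> = e / 2"
      using sums_unique[OF sums] by simp
    finally have "measure M (\<Union>i. U i - C i) \<le> e / 2" .
    moreover have "measure M ((\<Union>i. U i) - (\<Union>i. C i)) \<le> measure M (\<Union>i. U i - C i)"
      by (intro finite_measure_mono) auto
    ultimately have half: "measure M ((\<Union>i. U i) - (\<Union>i. C i)) \<le> e / 2"
      by simp
    let ?D = "\<lambda>n. (\<Union>i. U i) - (\<Union>i<n. C i)"
    have "range ?D \<subseteq> sets M"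
      by (rule image_subsetI) measurable
    moreover have "decseq ?D"
      unfolding decseq_def by (intro allI impI Diff_mono UN_mono) auto
    ultimately have "(\<lambda>n. measure M (?D n)) \<longlonglongrightarrow> measure M (\<Inter>n. ?D n)"
      by (rule finite_Lim_measure_decseq)
    moreover have "(\<Inter>n. ?D n) = (\<Union>i. U i) - (\<Union>i. C i)"
      by blast
    ultimately have "(\<lambda>n. measure M (?D n)) \<longlonglongrightarrow> measure M ((\<Union>i. U i) - (\<Union>i. C i))"
      by (simp only:)
    moreover have "measure M ((\<Union>i. U i) - (\<Union>i. C i)) < e"
      using half \<open>e > 0\<close> by simp
    ultimately have "\<forall>\<^sub>F n in sequentially. measure M (?D n) < e"
      by (rule order_tendstoD(2))
    then obtain n where "measure M (?D n) < e"
      unfolding eventually_sequentially by blast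
    moreover have "closedin X (\<Union>i<n. C i)"
      using C by (intro closedin_Union) auto
    moreover have "openin X (\<Union>i. U i)"
      using U by auto
    ultimately show ?case
      using CE EU by (intro exI[of _ "\<Union>i<n. C i"] exI[of _ "\<Union>i. U i"]) blast
  qed
  note approx = this
  have "\<exists>K\<subseteq>E. compactin X K \<and> measure M E < measure M K + e"
    if E: "E \<in> sets (borel_of X)" and e: "e > 0" for E and e :: real
  proof -
    obtain C U where CU: "closedin X C" "openin X U" "C \<subseteq> E" "E \<subseteq> U" "measure M (U - C) < e"
      using approx[of E e] E e by (auto simp: sets_borel_of)
    have "measure M E \<le> measure M U"
      using CU os by (intro finite_measure_mono) auto
    also have "measure M U = measure M C + measure M (U - C)"
      using CU os cs finite_measure_Diff[of U C] by auto
    finally have "measure M E < measure M C + e"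
      using CU(5) by simp
    then show ?thesis
      using CU closedin_compact_space[OF X(1)] by blast
  qed
  then show ?thesis
    by (subst regular_measure_iff_compact_approximation[OF metrizable_imp_Hausdorff_space[OF X(2)] M]) auto
qed


section \<open>The weak* topology\<close>

lemma continuous_map_integral:
  assumes "continuous_map Y euclideanreal f" "bounded (f ` topspace Y)"
  shows "continuous_map (prob_topology Y) euclideanreal (\<lambda>M. \<integral>y. f y \<partial>M)"
  unfolding continuous_map_def topspace_prob_topology
proof (intro conjI allI impI)
  fix V :: "real set" assume "openin euclideanreal V"
  then show "openin (prob_topology Y) {M \<in> prob_measures Y. (\<integral>y. f y \<partial>M) \<in> V}"
    unfolding prob_topology_def using assms
    by (intro topology_generated_by_Basis) auto
qed auto

text \<open>The universal property of the weak* topology as an initial topology.\<close>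

lemma continuous_map_into_prob_topology:
  assumes "\<And>x. x \<in> topspace Z \<Longrightarrow> h x \<in> prob_measures Y"
    and "\<And>f. continuous_map Y euclideanreal f \<Longrightarrow> bounded (f ` topspace Y) \<Longrightarrow>
      continuous_map Z euclideanreal (\<lambda>x. \<integral>y. f y \<partial>h x)"
  shows "continuous_map Z (prob_topology Y) h"
  unfolding prob_topology_def
proof (rule continuous_on_generated_topo)
  fix W
  assume "W \<in> {{M \<in> prob_measures Y. (\<integral>y. f y \<partial>M) \<in> V} | f V.
      continuous_map Y euclideanreal f \<and> bounded (f ` topspace Y) \<and> open V}"
  then obtain f V where W: "W = {M \<in> prob_measures Y. (\<integral>y. f y \<partial>M) \<in> V}"
      and f: "continuous_map Y euclideanreal f" "bounded (f ` topspace Y)" and V: "open V"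
    by blast
  have "h -` W \<inter> topspace Z = {x \<in> topspace Z. (\<integral>y. f y \<partial>h x) \<in> V}"
    using assms(1) by (auto simp: W)
  then show "openin Z (h -` W \<inter> topspace Z)"
    using assms(2)[OF f] V by (simp add: continuous_map_def)
next
  show "h ` topspace Z \<subseteq> \<Union> {{M \<in> prob_measures Y. (\<integral>y. f y \<partial>M) \<in> V} | f V.
      continuous_map Y euclideanreal f \<and> bounded (f ` topspace Y) \<and> open V}"
    using assms(1) topspace_prob_topology[of Y]
    unfolding prob_topology_def topology_generated_by_topspace by auto
qed

lemma integral_distr_continuous:
  fixes f :: "'b \<Rightarrow> real"
  assumes M: "M \<in> prob_measures Y" and h: "continuous_map Y Z h"
    and f: "continuous_map Z euclideanreal f"
  shows "(\<integral>z. f z \<partial>distr M (borel_of Z) h) = (\<integral>y. f (h y) \<partial>M)"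
proof (rule integral_distr)
  show "h \<in> M \<rightarrow>\<^sub>M borel_of Z"
    using continuous_map_borel_measurable[OF h] prob_measuresD(1)[OF M]
    by (simp cong: measurable_cong_sets)
qed (rule continuous_map_real_borel_measurable[OF f])

lemma continuous_map_distr:
  assumes h: "continuous_map Y Z h" and Y: "Hausdorff_space Y" and Z: "Hausdorff_space Z"
  shows "continuous_map (prob_topology Y) (prob_topology Z) (\<lambda>M. distr M (borel_of Z) h)"
proof (rule continuous_map_into_prob_topology)
  show "distr M (borel_of Z) h \<in> prob_measures Z" if "M \<in> topspace (prob_topology Y)" for M
    using distr_prob_measures[OF _ h Y Z] that by (simp add: topspace_prob_topology)
  fix f :: "'b \<Rightarrow> real"
  assume f: "continuous_map Z euclideanreal f" "bounded (f ` topspace Z)"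
  have "continuous_map (prob_topology Y) euclideanreal (\<lambda>M. \<integral>y. (f \<circ> h) y \<partial>M)"
    using h by (intro continuous_map_integral continuous_map_compose[OF h f(1)]
      bounded_subset[OF f(2)]) (auto simp: continuous_map_def)
  moreover have "(\<integral>y. (f \<circ> h) y \<partial>M) = (\<integral>z. f z \<partial>distr M (borel_of Z) h)"
    if "M \<in> topspace (prob_topology Y)" for M
    using that by (simp add: topspace_prob_topology integral_distr_continuous[OF _ h f(1)])
  ultimately show "continuous_map (prob_topology Y) euclideanreal
      (\<lambda>M. \<integral>z. f z \<partial>distr M (borel_of Z) h)"
    by (rule continuous_map_eq)
qed

lemma integral_point_mass:
  fixes f :: "'a \<Rightarrow> real"
  assumes "y \<in> topspace Y" "continuous_map Y euclideanreal f"
  shows "(\<integral>x. f x \<partial>point_mass Y y) = f y"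
  unfolding point_mass_def
  using assms by (intro integral_return continuous_map_real_borel_measurable) auto

lemma continuous_map_point_mass:
  assumes "Hausdorff_space Y"
  shows "continuous_map Y (prob_topology Y) (point_mass Y)"
proof (rule continuous_map_into_prob_topology)
  fix f :: "'a \<Rightarrow> real" assume "continuous_map Y euclideanreal f"
  then show "continuous_map Y euclideanreal (\<lambda>x. \<integral>y. f y \<partial>point_mass Y x)"
    by (rule continuous_map_eq) (metis integral_point_mass \<open>continuous_map Y euclideanreal f\<close>)
qed (rule point_mass_prob_measures[OF assms])

text \<open>Regularity provides a compact set inside \<open>U\<close> of measure above \<open>a\<close>; a Urysohn function
  separates it from the complement of \<open>U\<close>. Together with \<open>integral_le_measure_open\<close> this says
  that the measure of an open set is the supremum of the integrals of the continuous functions below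
  its indicator.\<close>

lemma continuous_function_below_open:
  assumes Y: "Hausdorff_space Y" "normal_space Y"
    and M: "M \<in> prob_measures Y" and U: "openin Y U" and a: "a < measure M U"
  obtains f where "continuous_map Y euclideanreal f" "\<And>x. x \<in> topspace Y \<Longrightarrow> f x \<in> {0..1}"
    "\<And>x. x \<in> topspace Y - U \<Longrightarrow> f x = 0" "a < (\<integral>x. f x \<partial>M)"
proof -
  note D = prob_measuresD[OF M]
  interpret prob_space M by (rule D)
  have "\<exists>K\<subseteq>U. compactin Y K \<and> measure M U < measure M K + (measure M U - a)"
    using regular_measure_iff_compact_approximation[OF Y(1) finite_measure_axioms D(1),
      THEN iffD1, OF D(4), rule_format, OF openin_imp_borel_of[OF U], of "measure M U - a"] a
    by simp
  then obtain K where K: "K \<subseteq> U" "compactin Y K" "a < measure M K"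
    by auto
  have "closedin Y (topspace Y - U)" "closedin Y K" "disjnt (topspace Y - U) K"
    using U K compactin_imp_closedin[OF Y(1)] by (auto simp: disjnt_def)
  from Urysohn_lemma[OF Y(2) this, of 0 1]
  obtain f where f: "continuous_map Y (top_of_set {0..1::real}) f"
      "f ` (topspace Y - U) \<subseteq> {0}" "f ` K \<subseteq> {1}"
    by auto
  have cf: "continuous_map Y euclideanreal f" and r: "\<And>x. x \<in> topspace Y \<Longrightarrow> f x \<in> {0..1}"
    using f(1) by (auto simp: continuous_map_in_subtopology)
  have Ks: "K \<in> sets M"
    using compactin_imp_borel_of[OF Y(1) K(2)] D(1) by simp
  have int: "integrable M f"
    using r by (intro integrable_bounded_continuous[OF M cf]) (auto simp: bounded_iff intro!: exI[of _ 1])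
  have le: "indicator K x \<le> f x" if "x \<in> space M" for x
    using r[of x] f(3) that by (auto simp: D(2) indicator_def)
  have "measure M K = (\<integral>x. indicator K x \<partial>M)"
    using Ks by simp
  also have "\<dots> \<le> (\<integral>x. f x \<partial>M)"
    using Ks le by (intro integral_mono int) (auto simp: less_top[symmetric])
  finally show thesis
    using K(3) f(2) by (intro that[OF cf r]) auto
qed

lemma integral_le_measure_open:
  assumes M: "M \<in> prob_measures Y" and U: "openin Y U"
    and f: "continuous_map Y euclideanreal f" "\<And>x. x \<in> topspace Y \<Longrightarrow> f x \<in> {0..1}"
      "\<And>x. x \<in> topspace Y - U \<Longrightarrow> f x = 0"
  shows "(\<integral>x. f x \<partial>M) \<le> measure M U"
proof -
  note D = prob_measuresD[OF M]
  interpret prob_space M by (rule D)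
  have Us: "U \<in> sets M"
    using openin_imp_borel_of[OF U] D(1) by simp
  have int: "integrable M f"
    using f(2) by (intro integrable_bounded_continuous[OF M f(1)]) (auto simp: bounded_iff intro!: exI[of _ 1])
  have "f x \<le> indicator U x" if "x \<in> space M" for x
    using f(2,3)[of x] that by (auto simp: D(2) indicator_def)
  then have "(\<integral>x. f x \<partial>M) \<le> (\<integral>x. indicator U x \<partial>M)"
    using Us by (intro integral_mono int) (auto simp: less_top[symmetric])
  also have "\<dots> = measure M U"
    using Us by simp
  finally show ?thesis .
qed

lemma prob_measures_eqI:
  assumes Y: "Hausdorff_space Y" "normal_space Y"
    and M: "M \<in> prob_measures Y" and N: "N \<in> prob_measures Y"
    and eq: "\<And>f. continuous_map Y euclideanreal f \<Longrightarrow> bounded (f ` topspace Y) \<Longrightarrow>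
      (\<integral>y. f y \<partial>M) = (\<integral>y. f y \<partial>N)"
  shows "M = N"
proof -
  have le: "measure M U \<le> measure N U"
    if M: "M \<in> prob_measures Y" and N: "N \<in> prob_measures Y" and U: "openin Y U"
      and eq: "\<And>f. continuous_map Y euclideanreal f \<Longrightarrow> bounded (f ` topspace Y) \<Longrightarrow>
        (\<integral>y. f y \<partial>M) = (\<integral>y. f y \<partial>N)" for M N U
  proof (rule ccontr)
    assume "\<not> measure M U \<le> measure N U"
    then obtain f where f: "continuous_map Y euclideanreal f" "\<And>x. x \<in> topspace Y \<Longrightarrow> f x \<in> {0..1}"
        "\<And>x. x \<in> topspace Y - U \<Longrightarrow> f x = 0" "measure N U < (\<integral>x. f x \<partial>M)"
      using continuous_function_below_open[OF Y M U, of "measure N U"] by force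
    have "(\<integral>x. f x \<partial>N) \<le> measure N U"
      by (rule integral_le_measure_open[OF N U f(1-3)])
    moreover have "bounded (f ` topspace Y)"
      using f(2) by (auto simp: bounded_iff intro!: exI[of _ 1])
    ultimately show False
      using eq[OF f(1)] f(4) by simp
  qed
  note DM = prob_measuresD[OF M] and DN = prob_measuresD[OF N]
  interpret M: prob_space M by (rule DM)
  interpret N: prob_space N by (rule DN)
  show ?thesis
  proof (rule measure_eqI_generator_eq[where E = "{U. openin Y U}" and A = "\<lambda>_::nat. topspace Y"])
    show "emeasure M U = emeasure N U" if "U \<in> {U. openin Y U}" for U
      using le[OF M N _ eq, of U] le[OF N M _ eq[symmetric], of U] that
      by (simp add: M.emeasure_eq_measure N.emeasure_eq_measure)
  qed (auto simp: Int_stable_def DM(1) DN(1) sets_borel_of dest: openin_subset)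
qed

lemma Hausdorff_space_prob_topology:
  assumes Y: "Hausdorff_space Y" "normal_space Y"
  shows "Hausdorff_space (prob_topology Y)"
  unfolding Hausdorff_space_def topspace_prob_topology
proof (intro allI impI)
  fix M N assume MN: "M \<in> prob_measures Y \<and> N \<in> prob_measures Y \<and> M \<noteq> N"
  then obtain f where f: "continuous_map Y euclideanreal f" "bounded (f ` topspace Y)"
      and ne: "(\<integral>y. f y \<partial>M) \<noteq> (\<integral>y. f y \<partial>N)"
    using prob_measures_eqI[OF Y] by blast
  obtain V W where VW: "open V" "open W" "(\<integral>y. f y \<partial>M) \<in> V" "(\<integral>y. f y \<partial>N) \<in> W" "V \<inter> W = {}"
    using hausdorff[OF ne] by blast
  have "openin (prob_topology Y) {L \<in> prob_measures Y. (\<integral>y. f y \<partial>L) \<in> S}" if "open S" for S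
    using continuous_map_integral[OF f] that by (simp add: continuous_map_def topspace_prob_topology)
  then show "\<exists>U V. openin (prob_topology Y) U \<and> openin (prob_topology Y) V \<and> M \<in> U \<and> N \<in> V \<and> disjnt U V"
    using VW MN by (intro exI[of _ "{L \<in> prob_measures Y. (\<integral>y. f y \<partial>L) \<in> V}"]
      exI[of _ "{L \<in> prob_measures Y. (\<integral>y. f y \<partial>L) \<in> W}"]) (auto simp: disjnt_def)
qed

text \<open>Weak* neighbourhoods are generated from conditions on single integrals, so convergence of every
  integral is enough.\<close>

lemma limitin_prob_topologyI:
  assumes Ms: "\<And>n. Ms n \<in> prob_measures Y" and M: "M \<in> prob_measures Y"
    and lim: "\<And>f. continuous_map Y euclideanreal f \<Longrightarrow> bounded (f ` topspace Y) \<Longrightarrow>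
      ((\<lambda>n. \<integral>y. f y \<partial>Ms n) \<longlongrightarrow> (\<integral>y. f y \<partial>M)) F"
  shows "limitin (prob_topology Y) Ms M F"
  unfolding limitin_def topspace_prob_topology
proof (intro conjI allI impI M)
  fix U assume "openin (prob_topology Y) U \<and> M \<in> U"
  then have "generate_topology_on {{M \<in> prob_measures Y. (\<integral>y. f y \<partial>M) \<in> V} | f V.
      continuous_map Y euclideanreal f \<and> bounded (f ` topspace Y) \<and> open V} U" "M \<in> U"
    by (auto simp: prob_topology_def openin_topology_generated_by_iff)
  then show "\<forall>\<^sub>F n in F. Ms n \<in> U"
  proof (induction rule: generate_topology_on.induct)
    case (Int a b)
    then show ?case
      by (auto intro: eventually_conj)
  next
    case (UN K)
    then obtain k where "k \<in> K" "\<forall>\<^sub>F n in F. Ms n \<in> k"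
      by blast
    then show ?case
      by (auto elim: eventually_mono)
  next
    case (Basis s)
    then obtain f V where s: "s = {M \<in> prob_measures Y. (\<integral>y. f y \<partial>M) \<in> V}"
      and f: "continuous_map Y euclideanreal f" "bounded (f ` topspace Y)" and V: "open V"
      by blast
    have "\<forall>\<^sub>F n in F. (\<integral>y. f y \<partial>Ms n) \<in> V"
      using Basis.prems by (intro topological_tendstoD[OF lim[OF f] V]) (simp add: s)
    then show ?case
      by (simp add: s Ms)
  qed simp
qed

lemma limitin_prob_topologyD:
  assumes "limitin (prob_topology Y) Ms M F"
    and "continuous_map Y euclideanreal f" "bounded (f ` topspace Y)"
  shows "((\<lambda>n. \<integral>y. f y \<partial>Ms n) \<longlongrightarrow> (\<integral>y. f y \<partial>M)) F"
  using continuous_map_limit[OF continuous_map_integral[OF assms(2,3)] assms(1)]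
  by (simp add: comp_def)

text \<open>Convergence to a point mass is controlled by a single test function, the distance to the point: a
  bounded continuous \<open>f\<close> differs from its value at \<open>y\<close> by at most a small constant plus a
  multiple of the distance to \<open>y\<close>.\<close>

lemma limitin_point_massI:
  fixes X :: "'a metric"
  assumes y: "y \<in> mspace X" and bdd: "bounded (mdist X y ` mspace X)"
    and Ms: "\<And>n. Ms n \<in> prob_measures (mtopology_of X)"
    and lim: "(\<lambda>n. \<integral>x. mdist X y x \<partial>Ms n) \<longlonglongrightarrow> 0"
  shows "limitin (prob_topology (mtopology_of X)) Ms (point_mass (mtopology_of X) y) sequentially"
proof (rule limitin_prob_topologyI[OF Ms])
  have H: "Hausdorff_space (mtopology_of X)"
    by (simp add: metrizable_imp_Hausdorff_space metrizable_space_mtopology_of)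
  show "point_mass (mtopology_of X) y \<in> prob_measures (mtopology_of X)"
    by (rule point_mass_prob_measures[OF H]) (simp add: y)
  fix f :: "'a \<Rightarrow> real"
  assume f: "continuous_map (mtopology_of X) euclideanreal f" "bounded (f ` topspace (mtopology_of X))"
  have fy: "(\<integral>x. f x \<partial>point_mass (mtopology_of X) y) = f y"
    using y f(1) by (intro integral_point_mass) auto
  obtain B where B: "B > 0" "\<And>x. x \<in> mspace X \<Longrightarrow> \<bar>f x\<bar> \<le> B"
    using f(2) unfolding bounded_pos by auto
  have cg: "continuous_map (mtopology_of X) euclideanreal (mdist X y)"
    by (rule continuous_on_mdist[OF y])
  have "(\<lambda>n. \<integral>x. f x \<partial>Ms n) \<longlonglongrightarrow> f y"
  proof (rule LIMSEQ_I)
    fix e :: real assume e: "e > 0"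
    have "openin (mtopology_of X) {x \<in> topspace (mtopology_of X). f x \<in> ball (f y) (e / 2)}"
      by (rule openin_continuous_map_preimage[OF f(1)]) simp
    then obtain r where r: "r > 0" "\<And>x. x \<in> mspace X \<Longrightarrow> mdist X y x < r \<Longrightarrow> \<bar>f x - f y\<bar> < e / 2"
      using y e unfolding mtopology_of_def
      by (auto simp: Metric_space.openin_mtopology[OF Metric_space_mspace_mdist] subset_iff
          Metric_space.in_mball[OF Metric_space_mspace_mdist] dist_real_def abs_minus_commute
          Metric_space.topspace_mtopology[OF Metric_space_mspace_mdist])
    \<comment> \<open>Near \<open>y\<close> continuity gives \<open>e / 2\<close>; at distance at least \<open>r\<close> the factor \<open>2 * B / r\<close>
      makes the second summand exceed the trivial bound \<open>2 * B\<close>.\<close>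
    have *: "\<bar>f x - f y\<bar> \<le> e / 2 + 2 * B / r * mdist X y x" if x: "x \<in> mspace X" for x
    proof (cases "mdist X y x < r")
      case True
      then show ?thesis
        using r(2)[OF x True] r(1) B(1) by (simp add: add_increasing2 less_imp_le)
    next
      case False
      have "\<bar>f x - f y\<bar> \<le> 2 * B / r * r"
        using B(2)[OF x] B(2)[OF y] r(1) by simp
      also have "\<dots> \<le> 2 * B / r * mdist X y x"
        using False r(1) B(1) by (intro mult_left_mono) auto
      finally show ?thesis using e by simp
    qed
    have int: "\<bar>(\<integral>x. f x \<partial>Ms n) - f y\<bar> \<le> e / 2 + 2 * B / r * (\<integral>x. mdist X y x \<partial>Ms n)" for n
    proof -
      interpret prob_space "Ms n" by (rule prob_measuresD[OF Ms])
      have i: "integrable (Ms n) f" "integrable (Ms n) (mdist X y)"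
        using f cg bdd by (auto intro!: integrable_bounded_continuous[OF Ms])
      have "\<bar>(\<integral>x. f x \<partial>Ms n) - f y\<bar> = \<bar>\<integral>x. f x - f y \<partial>Ms n\<bar>"
        using i by (simp add: prob_space)
      also have "\<dots> \<le> (\<integral>x. \<bar>f x - f y\<bar> \<partial>Ms n)"
        by (rule integral_abs_bound)
      also have "\<dots> \<le> (\<integral>x. e / 2 + 2 * B / r * mdist X y x \<partial>Ms n)"
        using i * by (intro integral_mono) (auto simp: prob_measuresD(2)[OF Ms])
      also have "\<dots> = e / 2 + 2 * B / r * (\<integral>x. mdist X y x \<partial>Ms n)"
        using i by (simp add: prob_space)
      finally show ?thesis .
    qed
    have "(\<lambda>n. e / 2 + 2 * B / r * (\<integral>x. mdist X y x \<partial>Ms n)) \<longlonglongrightarrow> e / 2 + 2 * B / r * 0"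
      by (intro tendsto_intros lim)
    then have "\<forall>\<^sub>F n in sequentially. e / 2 + 2 * B / r * (\<integral>x. mdist X y x \<partial>Ms n) < e"
      using e by (intro order_tendstoD(2)[where y = "e / 2 + 2 * B / r * 0"]) auto
    then have "\<forall>\<^sub>F n in sequentially. norm ((\<integral>x. f x \<partial>Ms n) - f y) < e"
      by eventually_elim (use int in \<open>fastforce intro: le_less_trans\<close>)
    then show "\<exists>no. \<forall>n\<ge>no. norm ((\<integral>x. f x \<partial>Ms n) - f y) < e"
      by (simp add: eventually_sequentially)
  qed
  then show "(\<lambda>n. \<integral>x. f x \<partial>Ms n) \<longlonglongrightarrow> (\<integral>x. f x \<partial>point_mass (mtopology_of X) y)"
    by (simp only: fy)
qed

section \<open>Barycenters\<close>

text \<open>As a supremum of weak* continuous functions, the measure of an open set is lower semicontinuous.\<close>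

lemma borel_measurable_measure_open:
  assumes Y: "Hausdorff_space Y" "normal_space Y" and U: "openin Y U"
  shows "(\<lambda>M. measure M U) \<in> borel_measurable (borel_of (prob_topology Y))"
  unfolding borel_measurable_iff_greater
proof
  fix a
  have "openin (prob_topology Y) {M \<in> prob_measures Y. a < measure M U}" (is "openin _ ?S")
  proof (subst openin_subopen, intro ballI)
    fix M assume "M \<in> ?S"
    then have M: "M \<in> prob_measures Y" "a < measure M U"
      by auto
    obtain f where f: "continuous_map Y euclideanreal f" "\<And>x. x \<in> topspace Y \<Longrightarrow> f x \<in> {0..1}"
        "\<And>x. x \<in> topspace Y - U \<Longrightarrow> f x = 0" "a < (\<integral>x. f x \<partial>M)"
      using continuous_function_below_open[OF Y M(1) U M(2)] by blast
    have "bounded (f ` topspace Y)"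
      using f(2) by (auto simp: bounded_iff intro!: exI[of _ 1])
    then have "openin (prob_topology Y) {N \<in> prob_measures Y. (\<integral>x. f x \<partial>N) \<in> {a<..}}"
      using openin_continuous_map_preimage[OF continuous_map_integral[OF f(1)], of "{a<..}"]
      by (simp add: topspace_prob_topology)
    moreover have "a < measure N U" if "N \<in> prob_measures Y" "a < (\<integral>x. f x \<partial>N)" for N
      using integral_le_measure_open[OF that(1) U f(1-3)] that(2) by simp
    ultimately show "\<exists>T. openin (prob_topology Y) T \<and> M \<in> T \<and> T \<subseteq> ?S"
      using M f(4) by (intro exI[of _ "{N \<in> prob_measures Y. (\<integral>x. f x \<partial>N) \<in> {a<..}}"]) auto
  qed
  then show "{M \<in> space (borel_of (prob_topology Y)). a < measure M U} \<in> sets (borel_of (prob_topology Y))"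
    by (simp add: openin_imp_borel_of topspace_prob_topology)
qed

text \<open>The Borel sets of the weak* topology refine the \<open>\<sigma>\<close>-algebra of the Giry monad, so the
  barycenter of a measure on measures is its monadic \<open>bind\<close> with the identity.\<close>

lemma measurable_prob_topology_subprob_algebra:
  assumes Y: "Hausdorff_space Y" "normal_space Y"
  shows "(\<lambda>M. M) \<in> borel_of (prob_topology Y) \<rightarrow>\<^sub>M subprob_algebra (borel_of Y)"
proof (rule measurable_subprob_algebra_generated[OF sets_borel_of])
  have m: "(\<lambda>M. emeasure M U) \<in> borel_measurable (borel_of (prob_topology Y))" if "openin Y U" for U
  proof -
    have "(\<lambda>M. ennreal (measure M U)) \<in> borel_measurable (borel_of (prob_topology Y))"
      using borel_measurable_measure_open[OF Y that] by measurable
    moreover have "emeasure M U = ennreal (measure M U)" if "M \<in> prob_measures Y" for M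
      using prob_measuresD(3)[OF that] by (simp add: finite_measure.emeasure_eq_measure prob_space_def)
    ultimately show ?thesis
      by (subst measurable_cong) (auto simp: topspace_prob_topology)
  qed
  show "(\<lambda>M. emeasure M U) \<in> borel_measurable (borel_of (prob_topology Y))"
    if "U \<in> {U. openin Y U}" for U
    using m that by simp
  show "(\<lambda>M. emeasure M (topspace Y)) \<in> borel_measurable (borel_of (prob_topology Y))"
    by (rule m) simp
  fix M assume "M \<in> space (borel_of (prob_topology Y))"
  then have "M \<in> prob_measures Y"
    by (simp add: topspace_prob_topology)
  note D = prob_measuresD[OF this]
  show "subprob_space M" "sets M = sets (borel_of Y)"
    using D by (auto intro: prob_space_imp_subprob_space)
qed (auto simp: Int_stable_def dest: openin_subset)

lemma barycenter_in_prob_measures: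
  assumes X: "compact_space X" "metrizable_space X" and L: "L \<in> prob_measures (prob_topology X)"
  shows "L \<bind> (\<lambda>M. M) \<in> prob_measures X"
proof -
  note D = prob_measuresD[OF L]
  interpret prob_space L by (rule D)
  have Y: "Hausdorff_space X" "normal_space X"
    using X(2) by (auto intro: metrizable_imp_Hausdorff_space metrizable_imp_normal_space)
  have m: "(\<lambda>M. M) \<in> L \<rightarrow>\<^sub>M subprob_algebra (borel_of X)"
    using measurable_prob_topology_subprob_algebra[OF Y] D(1) by (simp cong: measurable_cong_sets)
  have s: "sets (L \<bind> (\<lambda>M. M)) = sets (borel_of X)"
    using sets_bind_measurable[OF m not_empty] .
  have "prob_space (L \<bind> (\<lambda>M. M))"
    using m by (rule prob_space_bind[rotated])
      (auto intro!: AE_I2 prob_measuresD simp: D(2) topspace_prob_topology)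
  then show ?thesis
    using s compact_metrizable_imp_regular_measure[OF X _ s]
    by (auto simp: prob_measures_def prob_space_def)
qed

lemma integral_barycenter:
  fixes f :: "'a \<Rightarrow> real"
  assumes X: "compact_space X" "metrizable_space X" and L: "L \<in> prob_measures (prob_topology X)"
    and f: "continuous_map X euclideanreal f" "\<And>x. x \<in> topspace X \<Longrightarrow> 0 \<le> f x"
  shows "(\<integral>x. f x \<partial>(L \<bind> (\<lambda>M. M))) = (\<integral>M. (\<integral>x. f x \<partial>M) \<partial>L)"
proof -
  note D = prob_measuresD[OF L]
  interpret prob_space L by (rule D)
  have Y: "Hausdorff_space X" "normal_space X"
    using X(2) by (auto intro: metrizable_imp_Hausdorff_space metrizable_imp_normal_space)
  have m: "(\<lambda>M. M) \<in> L \<rightarrow>\<^sub>M subprob_algebra (borel_of X)"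
    using measurable_prob_topology_subprob_algebra[OF Y] D(1) by (simp cong: measurable_cong_sets)
  have b: "bounded (f ` topspace X)"
    by (rule bounded_if_compact_space[OF X(1) f(1)])
  have e: "(\<integral>\<^sup>+x. ennreal (f x) \<partial>M) = ennreal (\<integral>x. f x \<partial>M)" and nn: "0 \<le> (\<integral>x. f x \<partial>M)"
    if M: "M \<in> prob_measures X" for M
  proof -
    have pos: "0 \<le> f x" if "x \<in> space M" for x
      using f(2) that by (simp add: prob_measuresD(2)[OF M])
    show "(\<integral>\<^sup>+x. ennreal (f x) \<partial>M) = ennreal (\<integral>x. f x \<partial>M)"
      by (rule nn_integral_eq_integral[OF integrable_bounded_continuous[OF M f(1) b]]) (rule AE_I2[OF pos])
    show "0 \<le> (\<integral>x. f x \<partial>M)"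
      by (rule Bochner_Integration.integral_nonneg[OF pos])
  qed
  have cI: "continuous_map (prob_topology X) euclideanreal (\<lambda>M. \<integral>x. f x \<partial>M)"
    by (rule continuous_map_integral[OF f(1) b])
  obtain B where B: "\<And>x. x \<in> topspace X \<Longrightarrow> \<bar>f x\<bar> \<le> B"
    using b by (auto simp: bounded_iff)
  have "bounded ((\<lambda>M. \<integral>x. f x \<partial>M) ` topspace (prob_topology X))"
    using abs_integral_le_bound[OF _ f(1) B]
    by (auto simp: bounded_iff topspace_prob_topology intro!: exI[of _ B])
  then have iI: "integrable L (\<lambda>M. \<integral>x. f x \<partial>M)"
    by (rule integrable_bounded_continuous[OF L cI])
  have fm: "(\<lambda>x. ennreal (f x)) \<in> borel_measurable (borel_of X)"
    using continuous_map_real_borel_measurable[OF f(1)] by measurable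
  have bary: "L \<bind> (\<lambda>M. M) \<in> prob_measures X"
    by (rule barycenter_in_prob_measures[OF X L])
  have "ennreal (\<integral>x. f x \<partial>(L \<bind> (\<lambda>M. M))) = (\<integral>\<^sup>+x. ennreal (f x) \<partial>(L \<bind> (\<lambda>M. M)))"
    by (rule e[OF bary, symmetric])
  also have "\<dots> = (\<integral>\<^sup>+M. (\<integral>\<^sup>+x. ennreal (f x) \<partial>M) \<partial>L)"
    by (rule nn_integral_bind[OF fm m])
  also have "\<dots> = (\<integral>\<^sup>+M. ennreal (\<integral>x. f x \<partial>M) \<partial>L)"
    by (rule nn_integral_cong) (simp add: e D(2) topspace_prob_topology)
  also have "\<dots> = ennreal (\<integral>M. (\<integral>x. f x \<partial>M) \<partial>L)"
    by (rule nn_integral_eq_integral[OF iI]) (auto simp: D(2) topspace_prob_topology nn intro!: AE_I2)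
  finally have "ennreal (\<integral>x. f x \<partial>(L \<bind> (\<lambda>M. M))) = ennreal (\<integral>M. (\<integral>x. f x \<partial>M) \<partial>L)" .
  moreover have "0 \<le> (\<integral>M. (\<integral>x. f x \<partial>M) \<partial>L)"
    by (rule Bochner_Integration.integral_nonneg) (simp add: D(2) topspace_prob_topology nn)
  ultimately show ?thesis
    using nn[OF bary] by (simp only: ennreal_inj)
qed


section \<open>Measures of zero variance\<close>

lemma point_mass_eqI:
  assumes M: "M \<in> prob_measures Y" and y: "y \<in> topspace Y" and ae: "AE x in M. x = y"
  shows "M = point_mass Y y"
proof (rule measure_eqI)
  note D = prob_measuresD[OF M]
  interpret prob_space M by (rule D)
  show "sets M = sets (point_mass Y y)"
    by (simp add: point_mass_def D(1))
  fix E assume E: "E \<in> sets M"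
  have "emeasure M E = emeasure M (if y \<in> E then space M else {})"
    using ae E sets.sets_into_space[OF E] by (intro emeasure_eq_AE) (auto elim!: eventually_mono)
  then show "emeasure M E = emeasure (point_mass Y y) E"
    using E D(1) by (simp add: point_mass_def emeasure_space_1)
qed

text \<open>The distance to each point \<open>y\<close> is almost surely a constant \<open>c y\<close>. If no \<open>c y\<close> were
  zero, the open balls with centers \<open>y\<close> and radii \<open>c y\<close> would be null sets covering the
  space, and by compactness the whole space would be null. So \<open>c y = 0\<close> for some \<open>y\<close>, and
  almost every point is at distance zero from it.\<close>

lemma zero_variance_imp_point_mass:
  fixes X :: "'a metric"
  assumes X: "compact_space (mtopology_of X)" and M: "M \<in> prob_measures (mtopology_of X)"
    and var: "\<And>f. continuous_map (mtopology_of X) euclideanreal f \<Longrightarrow>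
      (\<integral>x. (f x)\<^sup>2 \<partial>M) = (\<integral>x. f x \<partial>M)\<^sup>2"
  obtains y where "y \<in> mspace X" "M = point_mass (mtopology_of X) y"
proof -
  note D = prob_measuresD[OF M]
  interpret prob_space M by (rule D)
  have sp: "space M = mspace X"
    by (simp add: D(2))
  define c where "c y = (\<integral>x. mdist X y x \<partial>M)" for y
  have ae: "AE x in M. mdist X y x = c y" if y: "y \<in> mspace X" for y
  proof -
    have cf: "continuous_map (mtopology_of X) euclideanreal (mdist X y)"
      by (rule continuous_on_mdist[OF y])
    have cq: "continuous_map (mtopology_of X) euclideanreal (\<lambda>x. (mdist X y x)\<^sup>2)"
      by (intro continuous_map_real_pow cf)
    have i: "integrable M (mdist X y)" "integrable M (\<lambda>x. (mdist X y x)\<^sup>2)"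
      using cf cq by (auto intro!: integrable_bounded_continuous[OF M] bounded_if_compact_space[OF X, simplified])
    have "(\<integral>x. (mdist X y x - c y)\<^sup>2 \<partial>M) = 0"
      using variance_eq[OF i] var[OF cf] by (simp add: c_def)
    moreover have "integrable M (\<lambda>x. (mdist X y x - c y)\<^sup>2)"
      using i by (simp add: power2_diff)
    ultimately have "AE x in M. (mdist X y x - c y)\<^sup>2 = 0"
      by (subst (asm) integral_nonneg_eq_0_iff_AE) auto
    then show ?thesis
      by simp
  qed
  have nonneg: "0 \<le> c y" for y
    unfolding c_def by (intro Bochner_Integration.integral_nonneg) simp
  \<comment> \<open>Otherwise the balls \<open>mball_of X y (c y)\<close> form an open cover by null sets.\<close>
  have "\<exists>y\<in>mspace X. c y = 0"
  proof (rule ccontr)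
    assume "\<not> (\<exists>y\<in>mspace X. c y = 0)"
    with nonneg have pos: "0 < c y" if "y \<in> mspace X" for y
      using that less_eq_real_def by force
    have op: "openin (mtopology_of X) (mball_of X y (c y))" for y
      by (simp add: mtopology_of_def mball_of_def Metric_space.openin_mball)
    have self: "y \<in> mball_of X y (c y)" if "y \<in> mspace X" for y
      using pos[OF that] that by (simp add: mdist_zero[THEN iffD2])
    let ?b = "\<lambda>y. mball_of X y (c y)"
    have "\<exists>\<F>. finite \<F> \<and> \<F> \<subseteq> ?b ` mspace X \<and> mspace X \<subseteq> \<Union>\<F>"
      using X[unfolded compact_space_alt topspace_mtopology_of, rule_format, of "?b ` mspace X"] op self
      by blast
    then obtain \<F> where \<F>: "finite \<F>" "\<F> \<subseteq> ?b ` mspace X" "mspace X \<subseteq> \<Union>\<F>"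
      by blast
    obtain F where F: "finite F" "F \<subseteq> mspace X" "mspace X \<subseteq> (\<Union>y\<in>F. ?b y)"
      using finite_subset_image[OF \<F>(1,2)] \<F>(3) by blast
    have "AE x in M. \<forall>y\<in>F. mdist X y x = c y"
      using F ae by (intro AE_finite_allI) auto
    then have "AE x in M. False"
      using AE_space
    proof eventually_elim
      case (elim x)
      then obtain y where "y \<in> F" "x \<in> mball_of X y (c y)"
        using F(3) sp by blast
      then show ?case
        using elim(1) by simp
    qed
    then show False
      by simp
  qed
  then obtain y where y: "y \<in> mspace X" "c y = 0"
    by blast
  have "AE x in M. x = y"
    using ae[OF y(1)] AE_space by eventually_elim (use y sp in auto)
  then show thesis
    using y(1) by (intro that[OF y(1)] point_mass_eqI[OF M]) auto
qed

section \<open>Strong proximality\<close>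

text \<open>Averaging: contracting the barycenter contracts almost all the measures that it is the average of,
  at least along a subsequence.\<close>

lemma strongly_proximal_imp_strongly_proximal_induced:
  fixes X :: "'a metric"
  assumes X: "compact_space (mtopology_of X)"
    and act: "\<And>t. continuous_map (mtopology_of X) (mtopology_of X) (act t)"
    and prox: "strongly_proximal (mtopology_of X) act"
  shows "strongly_proximal (prob_topology (mtopology_of X)) (induced_action (mtopology_of X) act)"
  unfolding strongly_proximal_def
proof
  let ?X = "mtopology_of X" let ?P = "prob_topology ?X" let ?a = "induced_action ?X act"
  fix L assume L: "L \<in> prob_measures ?P"
  note D = prob_measuresD[OF L]
  interpret prob_space L by (rule D)
  have met: "metrizable_space ?X"
    by (rule metrizable_space_mtopology_of)
  have H: "Hausdorff_space ?X" and N: "normal_space ?X"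
    using met by (auto intro: metrizable_imp_Hausdorff_space metrizable_imp_normal_space)
  have HP: "Hausdorff_space ?P"
    by (rule Hausdorff_space_prob_topology[OF H N])
  have ca: "continuous_map ?P ?P (?a t)" for t
    unfolding induced_action_def by (rule continuous_map_distr[OF act H H])
  have aP: "?a t M \<in> prob_measures ?X" if "M \<in> prob_measures ?X" for t M
    unfolding induced_action_def by (rule distr_prob_measures[OF that act H H])
  obtain t y where y: "y \<in> mspace X"
    and lim: "limitin ?P (\<lambda>n. ?a (t n) (L \<bind> (\<lambda>M. M))) (point_mass ?X y) sequentially"
    using prox barycenter_in_prob_measures[OF X met L] unfolding strongly_proximal_def by fastforce
  have pmP: "point_mass ?X y \<in> prob_measures ?X"
    using y by (intro point_mass_prob_measures[OF H]) simp
  let ?g = "mdist X y"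
  have cg: "continuous_map ?X euclideanreal ?g"
    by (rule continuous_on_mdist[OF y])
  have bg: "bounded (?g ` topspace ?X)"
    by (rule bounded_if_compact_space[OF X cg])
  obtain B where B: "\<And>x. x \<in> topspace ?X \<Longrightarrow> \<bar>?g x\<bar> \<le> B"
    using bg by (auto simp: bounded_iff)
  define u where "u n M = (\<integral>x. ?g x \<partial>?a (t n) M)" for n M
  have u_nonneg: "0 \<le> u n M" for n M
    unfolding u_def by (intro Bochner_Integration.integral_nonneg) simp
  have cu: "continuous_map ?P euclideanreal (u n)" for n
    using continuous_map_compose[OF ca continuous_map_integral[OF cg bg]]
    by (simp add: u_def[abs_def] comp_def)
  have iu: "integrable L (u n)" for n
  proof (rule integrable_bounded_continuous[OF L cu])
    show "bounded (u n ` topspace ?P)"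
      using abs_integral_le_bound[OF aP cg B]
      by (auto simp: bounded_iff u_def topspace_prob_topology intro!: exI[of _ B])
  qed
  \<comment> \<open>The \<open>L\<^sup>1\<close>-norm of \<open>u n\<close> is an integral against the translated barycenter, hence tends to
    the distance from \<open>y\<close> to itself.\<close>
  have "(\<integral>M. norm (u n M) \<partial>L) = (\<integral>x. ?g x \<partial>?a (t n) (L \<bind> (\<lambda>M. M)))" for n
  proof -
    have cgt: "continuous_map ?X euclideanreal (\<lambda>x. ?g (act (t n) x))"
      using continuous_map_compose[OF act cg] by (simp add: comp_def)
    have "(\<integral>x. ?g x \<partial>?a (t n) (L \<bind> (\<lambda>M. M))) = (\<integral>x. ?g (act (t n) x) \<partial>(L \<bind> (\<lambda>M. M)))"
      unfolding induced_action_def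
      by (rule integral_distr_continuous[OF barycenter_in_prob_measures[OF X met L] act cg])
    also have "\<dots> = (\<integral>M. (\<integral>x. ?g (act (t n) x) \<partial>M) \<partial>L)"
      by (rule integral_barycenter[OF X met L cgt]) simp
    also have "\<dots> = (\<integral>M. norm (u n M) \<partial>L)"
      by (rule Bochner_Integration.integral_cong[OF refl])
        (simp add: u_nonneg, simp add: u_def induced_action_def D(2) topspace_prob_topology
          integral_distr_continuous[OF _ act cg])
    finally show ?thesis by simp
  qed
  moreover have self: "?g y = 0"
    using y by simp
  then have "(\<lambda>n. \<integral>x. ?g x \<partial>?a (t n) (L \<bind> (\<lambda>M. M))) \<longlonglongrightarrow> 0"
    using limitin_prob_topologyD[OF lim cg bg] integral_point_mass[OF _ cg, of y] y self by simp
  ultimately have "(\<lambda>n. \<integral>M. norm (u n M) \<partial>L) \<longlonglongrightarrow> 0"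
    by simp
  then obtain r where r: "AE M in L. (\<lambda>n. u (r n) M) \<longlonglongrightarrow> 0"
    using tendsto_L1_AE_subseq[of L u] iu by auto
  have ae: "AE M in L. limitin ?P (\<lambda>n. ?a (t (r n)) M) (point_mass ?X y) sequentially"
    using r AE_space
  proof eventually_elim
    case (elim M)
    then show ?case
      using bg by (intro limitin_point_massI y aP) (auto simp: u_def D(2) topspace_prob_topology)
  qed
  have "limitin (prob_topology ?P) (\<lambda>n. induced_action ?P ?a (t (r n)) L)
      (point_mass ?P (point_mass ?X y)) sequentially"
  proof (rule limitin_prob_topologyI)
    show "induced_action ?P ?a (t (r n)) L \<in> prob_measures ?P" for n
      unfolding induced_action_def[of ?P] by (rule distr_prob_measures[OF L ca HP HP])
    show "point_mass ?P (point_mass ?X y) \<in> prob_measures ?P"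
      using pmP by (intro point_mass_prob_measures[OF HP]) (simp add: topspace_prob_topology)
    fix F :: "'a measure \<Rightarrow> real"
    assume F: "continuous_map ?P euclideanreal F" "bounded (F ` topspace ?P)"
    obtain C where C: "\<And>M. M \<in> prob_measures ?X \<Longrightarrow> \<bar>F M\<bar> \<le> C"
      using F(2) by (auto simp: bounded_iff topspace_prob_topology)
    have "(\<lambda>n. \<integral>M. F (?a (t (r n)) M) \<partial>L) \<longlonglongrightarrow> (\<integral>M. F (point_mass ?X y) \<partial>L)"
    proof (rule integral_dominated_convergence[where w = "\<lambda>_. C"])
      show "AE M in L. (\<lambda>n. F (?a (t (r n)) M)) \<longlonglongrightarrow> F (point_mass ?X y)"
        using ae by eventually_elim (drule continuous_map_limit[OF F(1)], simp add: comp_def)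
      show "(\<lambda>M. F (?a (t (r n)) M)) \<in> borel_measurable L" for n
        using continuous_map_real_borel_measurable[OF continuous_map_compose[OF ca F(1)]] D(1)
        by (simp add: comp_def cong: measurable_cong_sets)
      show "AE M in L. norm (F (?a (t (r n)) M)) \<le> C" for n
        using AE_space by eventually_elim (use C aP in \<open>simp add: D(2) topspace_prob_topology\<close>)
    qed auto
    then show "(\<lambda>n. \<integral>M. F M \<partial>induced_action ?P ?a (t (r n)) L)
        \<longlonglongrightarrow> (\<integral>M. F M \<partial>point_mass ?P (point_mass ?X y))"
      using pmP
      by (simp add: induced_action_def[of ?P] integral_distr_continuous[OF L ca F(1)]
          integral_point_mass[OF _ F(1)] topspace_prob_topology prob_space)
  qed
  then show "\<exists>t. \<exists>y\<in>topspace ?P. limitin (prob_topology ?P)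
      (\<lambda>n. induced_action ?P ?a (t n) L) (point_mass ?P y) sequentially"
    using pmP by (intro exI[of _ "\<lambda>n. t (r n)"] bexI[of _ "point_mass ?X y"])
      (auto simp: topspace_prob_topology)
qed

text \<open>Embedding: the point masses form an invariant copy of the action inside the induced one, and the
  variances show that limits of that copy do not leave it.\<close>

lemma strongly_proximal_induced_imp_strongly_proximal:
  fixes X :: "'a metric"
  assumes X: "compact_space (mtopology_of X)"
    and act: "\<And>t. continuous_map (mtopology_of X) (mtopology_of X) (act t)"
    and prox: "strongly_proximal (prob_topology (mtopology_of X)) (induced_action (mtopology_of X) act)"
  shows "strongly_proximal (mtopology_of X) act"
  unfolding strongly_proximal_def
proof
  let ?X = "mtopology_of X" let ?P = "prob_topology ?X" let ?a = "induced_action ?X act"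
  fix M assume M: "M \<in> prob_measures ?X"
  have met: "metrizable_space ?X"
    by (rule metrizable_space_mtopology_of)
  have H: "Hausdorff_space ?X" and N: "normal_space ?X"
    using met by (auto intro: metrizable_imp_Hausdorff_space metrizable_imp_normal_space)
  have HP: "Hausdorff_space ?P"
    by (rule Hausdorff_space_prob_topology[OF H N])
  have ca: "continuous_map ?P ?P (?a t)" for t
    unfolding induced_action_def by (rule continuous_map_distr[OF act H H])
  have aM: "?a t M \<in> prob_measures ?X" for t
    unfolding induced_action_def by (rule distr_prob_measures[OF M act H H])
  have cpm: "continuous_map ?X ?P (point_mass ?X)"
    by (rule continuous_map_point_mass[OF H])
  define L where "L = distr M (borel_of ?P) (point_mass ?X)"
  have L: "L \<in> prob_measures ?P"
    unfolding L_def by (rule distr_prob_measures[OF M cpm H HP])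
  obtain t m where m: "m \<in> prob_measures ?X"
    and lim: "limitin (prob_topology ?P) (\<lambda>n. induced_action ?P ?a (t n) L) (point_mass ?P m) sequentially"
    using prox L unfolding strongly_proximal_def topspace_prob_topology by blast
  have int_L: "(\<integral>N. F N \<partial>induced_action ?P ?a s L) = (\<integral>x. F (?a s (point_mass ?X x)) \<partial>M)"
    if F: "continuous_map ?P euclideanreal F" for F :: "'a measure \<Rightarrow> real" and s
    using integral_distr_continuous[OF L ca F] 
      integral_distr_continuous[OF M cpm continuous_map_compose[OF ca F]]
    by (simp add: induced_action_def[of ?P] L_def comp_def)
  have conv: "(\<lambda>n. \<integral>x. F (?a (t n) (point_mass ?X x)) \<partial>M) \<longlonglongrightarrow> F m"
    if F: "continuous_map ?P euclideanreal F" "bounded (F ` topspace ?P)" for F :: "'a measure \<Rightarrow> real"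
    using limitin_prob_topologyD[OF lim F] integral_point_mass[OF _ F(1)] m
    by (simp add: int_L[OF F(1)] topspace_prob_topology)
  have int_a: "(\<integral>z. f z \<partial>?a s (point_mass ?X x)) = f (act s x)"
    if "continuous_map ?X euclideanreal f" "x \<in> mspace X" for f :: "'a \<Rightarrow> real" and s x
    using integral_distr_continuous[OF point_mass_prob_measures[OF H] act that(1)]
      integral_point_mass[OF _ continuous_map_compose[OF act that(1)]] that(2)
    by (simp add: induced_action_def comp_def)
  have bdd_int: "bounded ((\<lambda>N. \<integral>x. f x \<partial>N) ` topspace ?P)"
    if f: "continuous_map ?X euclideanreal f" for f :: "'a \<Rightarrow> real"
  proof -
    obtain B where "\<And>x. x \<in> topspace ?X \<Longrightarrow> \<bar>f x\<bar> \<le> B"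
      using bounded_if_compact_space[OF X f] by (auto simp: bounded_iff)
    then show ?thesis
      using abs_integral_le_bound[OF _ f] by (auto simp: bounded_iff topspace_prob_topology)
  qed
  \<comment> \<open>Test functions on the upper level of the form \<open>N \<mapsto> \<integral>x. f x \<partial>N\<close> identify \<open>m\<close> as the
    weak* limit of the translates of \<open>M\<close>.\<close>
  have weak: "(\<lambda>n. \<integral>x. f x \<partial>?a (t n) M) \<longlonglongrightarrow> (\<integral>x. f x \<partial>m)"
    if f: "continuous_map ?X euclideanreal f" for f :: "'a \<Rightarrow> real"
  proof -
    have "(\<integral>x. (\<integral>z. f z \<partial>?a s (point_mass ?X x)) \<partial>M) = (\<integral>x. f x \<partial>?a s M)" for s
      unfolding induced_action_def[of _ _ _ M] integral_distr_continuous[OF M act f]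
      by (rule Bochner_Integration.integral_cong[OF refl]) (simp add: int_a[OF f] prob_measuresD(2)[OF M])
    then show ?thesis
      using conv[OF continuous_map_integral[OF f bounded_if_compact_space[OF X f]] bdd_int[OF f]]
      by simp
  qed
  have "(\<integral>x. (f x)\<^sup>2 \<partial>m) = (\<integral>x. f x \<partial>m)\<^sup>2"
    if f: "continuous_map ?X euclideanreal f" for f :: "'a \<Rightarrow> real"
  proof -
    have f2: "continuous_map ?X euclideanreal (\<lambda>x. (f x)\<^sup>2)"
      by (intro continuous_map_real_pow f)
    \<comment> \<open>The variance of \<open>f\<close>, as a bounded continuous test function on the upper level; it vanishes
      at every translate of a point mass because these are point masses.\<close>
    let ?V = "\<lambda>N. (\<integral>x. (f x)\<^sup>2 \<partial>N) - (\<integral>x. f x \<partial>N)\<^sup>2"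
    note cI = continuous_map_integral[OF f bounded_if_compact_space[OF X f]]
    note cI2 = continuous_map_integral[OF f2 bounded_if_compact_space[OF X f2]]
    have "continuous_map ?P euclideanreal ?V"
      by (intro continuous_map_diff continuous_map_real_pow cI cI2)
    moreover have "bounded (?V ` topspace ?P)"
    proof -
      obtain B C where B: "\<And>N. N \<in> topspace ?P \<Longrightarrow> \<bar>\<integral>x. f x \<partial>N\<bar> \<le> B"
        and C: "\<And>N. N \<in> topspace ?P \<Longrightarrow> \<bar>\<integral>x. (f x)\<^sup>2 \<partial>N\<bar> \<le> C"
        using bdd_int[OF f] bdd_int[OF f2] by (auto simp: bounded_iff)
      have "\<bar>?V N\<bar> \<le> C + B\<^sup>2" if "N \<in> topspace ?P" for N
      proof -
        have "(\<integral>x. f x \<partial>N)\<^sup>2 \<le> B\<^sup>2"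
          using power_mono[OF B[OF that], of 2] by simp
        then show ?thesis
          using C[OF that] abs_triangle_ineq4[of "\<integral>x. (f x)\<^sup>2 \<partial>N" "(\<integral>x. f x \<partial>N)\<^sup>2"]
          unfolding abs_power2 by linarith
      qed
      then show ?thesis
        by (auto simp: bounded_iff)
    qed
    ultimately have "(\<lambda>n. \<integral>x. ?V (?a (t n) (point_mass ?X x)) \<partial>M) \<longlonglongrightarrow> ?V m"
      by (rule conv)
    moreover have "(\<integral>x. ?V (?a s (point_mass ?X x)) \<partial>M) = (\<integral>x. 0 \<partial>M)" for s
      by (rule Bochner_Integration.integral_cong[OF refl])
        (simp add: int_a[OF f] int_a[OF f2] prob_measuresD(2)[OF M])
    ultimately have "(\<lambda>n::nat. 0) \<longlonglongrightarrow> ?V m"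
      by simp
    then show ?thesis
      using LIMSEQ_unique tendsto_const by fastforce
  qed
  then obtain y where y: "y \<in> mspace X" "m = point_mass ?X y"
    using zero_variance_imp_point_mass[OF X m] by blast
  have "limitin ?P (\<lambda>n. ?a (t n) M) (point_mass ?X y) sequentially"
    using weak y(2) m by (intro limitin_prob_topologyI aM) auto
  then show "\<exists>t. \<exists>y\<in>topspace ?X. limitin ?P (\<lambda>n. ?a (t n) M) (point_mass ?X y) sequentially"
    using y(1) by (intro exI[of _ t] bexI[of _ y]) auto
qed

theorem theorem1:
  fixes X :: "'a metric"
    and act :: "'t::topological_semigroup_mult \<Rightarrow> 'a \<Rightarrow> 'a"
  assumes "compact_space (mtopology_of X)"
    and "semigroup_action (mtopology_of X) act"
  shows "strongly_proximal (mtopology_of X) act \<longleftrightarrow>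
    strongly_proximal (prob_topology (mtopology_of X)) (induced_action (mtopology_of X) act)"
proof -
  have act: "continuous_map (mtopology_of X) (mtopology_of X) (act t)" for t
    using assms(2) by (simp add: semigroup_action_def)
  show ?thesis
    using strongly_proximal_imp_strongly_proximal_induced[where act = act, OF assms(1) act]
      strongly_proximal_induced_imp_strongly_proximal[where act = act, OF assms(1) act] by blast
qed

end
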